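(* Let $\alpha \in \mathbb{R}_{>0}$ and let $\mathbb{N}_0[\alpha]$ denote the additive monoid $\{f(\alpha) : f(X) \in \mathbb{N}_0[X]\} \subseteq \mathbb{R}$. Then: (1) $\alpha$ is transcendental if and only if $\mathbb{N}_0[\alpha]$ is a UFM that is not finitely generated. (2) If $\alpha$ is algebraic of degree $d$ with minimal polynomial $m_\alpha(X)$ and minimal pair $(p(X),q(X))$, then the following are equivalent: (a) $\mathbb{N}_0[\alpha]$ is a UFM; (b) $\mathbb{N}_0[\alpha]$ is an HFM; (c) $\deg m_\alpha(X) = |\mathcal{A}(\mathbb{N}_0[\alpha])|$; (d) $p(X) = X^n$ for some $n \in \mathbb{N}$.
   Context: All monoids are commutative and cancellative, written additively; $\mathbb{N}_0[\alpha]$ is reduced (its only invertible element is $0$). An atom of a reduced monoid $M$ is an element $a \neq 0$ such that $a = x+y$ with $x,y\in M$ implies $x=0$ or $y=0$; $\mathcal{A}(M)$ is the set of atoms; $M$ is atomic if it is generated by $\mathcal{A}(M)$. For atomic $M$, $\mathsf{Z}(M)$ is the free commutative monoid on $\mathcal{A}(M)$, a factorization of $x\in M$ is an element of $\mathsf{Z}(M)$ mapping to $x$ under the natural homomorphism $\mathsf{Z}(M)\to M$, and its length is its number of atoms counted with repetition. $M$ is a UFM (unique factorization monoid) if it is atomic and every element has exactly one factorization; an HFM (half-factorial monoid) if it is atomic and any two factorizations of the same element have the same length. A monoid is finitely generated if it is generated by a finite set. For an algebraic $\alpha$ with minimal polynomial $m_\alpha(X)\in\mathbb{Q}[X]$ (monic),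 let $\ell$ be the unique positive integer with $\ell m_\alpha(X)\in\mathbb{Z}[X]$ of content $1$; the minimal pair of $\alpha$ is the unique pair $(p(X),q(X))$ of polynomials in $\mathbb{N}_0[X]$ with $\ell m_\alpha(X) = p(X)-q(X)$ and the supports (sets of exponents of monomials with nonzero coefficient) of $p$ and $q$ disjoint. *)

theory Defs
  imports "HOL-Computational_Algebra.Computational_Algebra" "HOL-Library.Multiset"
begin

section \<open>Submonoids of a cancellative commutative monoid\<close>

text \<open>
  Monoids are given as submonoids \<open>M\<close> of an ambient type of class
  \<^class>\<open>cancel_comm_monoid_add\<close>.  The notions from \<open>atoms\<close> on are the usual
  ones when \<open>M\<close> is in addition reduced; lemmas \<open>add_submonoid_nat_adjoin\<close> and
  \<open>reduced_nat_adjoin\<close> below show that the monoids considered here qualify.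
\<close>

definition add_submonoid :: "'a::cancel_comm_monoid_add set \<Rightarrow> bool" where
  "add_submonoid M \<longleftrightarrow> 0 \<in> M \<and> (\<forall>x\<in>M. \<forall>y\<in>M. x + y \<in> M)"

definition reduced :: "'a::cancel_comm_monoid_add set \<Rightarrow> bool" where
  "reduced M \<longleftrightarrow> (\<forall>x\<in>M. \<forall>y\<in>M. x + y = 0 \<longrightarrow> x = 0)"

definition finitely_generated :: "'a::cancel_comm_monoid_add set \<Rightarrow> bool" where
  "finitely_generated M \<longleftrightarrow> (\<exists>G. finite G \<and> add_submonoid hull G = M)"

definition atoms :: "'a::cancel_comm_monoid_add set \<Rightarrow> 'a set" where
  "atoms M = {a \<in> M. a \<noteq> 0 \<and> (\<forall>x\<in>M. \<forall>y\<in>M. a = x + y \<longrightarrow> x = 0 \<or> y = 0)}"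

definition atomic :: "'a::cancel_comm_monoid_add set \<Rightarrow> bool" where
  "atomic M \<longleftrightarrow> add_submonoid hull (atoms M) = M"

text \<open>
  The free commutative monoid on the atoms consists of the finite multisets of atoms;
  its natural homomorphism to \<open>M\<close> is \<^const>\<open>sum_mset\<close>, and the length of a factorization
  is its \<^const>\<open>size\<close>.
\<close>

definition factorizations :: "'a::cancel_comm_monoid_add set \<Rightarrow> 'a \<Rightarrow> 'a multiset set" where
  "factorizations M x = {z. set_mset z \<subseteq> atoms M \<and> sum_mset z = x}"

definition UFM :: "'a::cancel_comm_monoid_add set \<Rightarrow> bool" where
  "UFM M \<longleftrightarrow> atomic M \<and> (\<forall>x\<in>M. \<exists>!z. z \<in> factorizations M x)"

definition HFM :: "'a::cancel_comm_monoid_add set \<Rightarrow> bool" where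
  "HFM M \<longleftrightarrow> atomic M \<and>
     (\<forall>x\<in>M. \<forall>z\<in>factorizations M x. \<forall>z'\<in>factorizations M x. size z = size z')"


section \<open>The monoid of values at \<open>\<alpha>\<close> of polynomials over the natural numbers\<close>

definition nat_adjoin :: "real \<Rightarrow> real set" where
  "nat_adjoin \<alpha> = {poly (map_poly of_nat f) \<alpha> |f :: nat poly. True}"

lemma add_submonoid_nat_adjoin: "add_submonoid (nat_adjoin \<alpha>)"
proof -
  have "0 = poly (map_poly of_nat (0 :: nat poly)) \<alpha>"
    by simp
  moreover have "poly (map_poly of_nat f) \<alpha> + poly (map_poly of_nat g) \<alpha>
      = poly (map_poly of_nat (f + g)) \<alpha>" for f g :: "nat poly"
  proof -
    have "map_poly of_nat (f + g) = map_poly of_nat f + (map_poly of_nat g :: real poly)"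
      by (simp add: poly_eq_iff coeff_map_poly)
    then show ?thesis by simp
  qed
  ultimately show ?thesis
    unfolding add_submonoid_def nat_adjoin_def by blast
qed

lemma nat_adjoin_nonneg:
  assumes "\<alpha> > 0" "x \<in> nat_adjoin \<alpha>"
  shows "x \<ge> 0"
  using assms by (auto simp: nat_adjoin_def poly_altdef coeff_map_poly intro!: sum_nonneg)

lemma reduced_nat_adjoin: "\<alpha> > 0 \<Longrightarrow> reduced (nat_adjoin \<alpha>)"
  unfolding reduced_def by (metis nat_adjoin_nonneg add_nonneg_eq_0_iff)


section \<open>Minimal polynomial and minimal pair\<close>

definition is_min_poly :: "real \<Rightarrow> rat poly \<Rightarrow> bool" where
  "is_min_poly \<alpha> m \<longleftrightarrow> lead_coeff m = 1 \<and> poly (map_poly of_rat m) \<alpha> = 0 \<and>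
     (\<forall>g. g \<noteq> 0 \<and> poly (map_poly of_rat g) \<alpha> = 0 \<longrightarrow> degree m \<le> degree g)"

definition min_poly :: "real \<Rightarrow> rat poly" where
  "min_poly \<alpha> = (THE m. is_min_poly \<alpha> m)"

text \<open>Below, \<open>F\<close> is the primitive integer polynomial \<open>\<ell> m\<^sub>\<alpha>\<close>.\<close>

definition is_minimal_pair :: "real \<Rightarrow> nat poly \<times> nat poly \<Rightarrow> bool" where
  "is_minimal_pair \<alpha> = (\<lambda>(p, q). \<exists>(l::nat) (F::int poly). l > 0 \<and>
     map_poly of_int F = smult (of_nat l) (min_poly \<alpha>) \<and> content F = 1 \<and>
     F = map_poly int p - map_poly int q \<and>
     {i. coeff p i \<noteq> 0} \<inter> {i. coeff q i \<noteq> 0} = {})"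

definition minimal_pair :: "real \<Rightarrow> nat poly \<times> nat poly" where
  "minimal_pair \<alpha> = (THE pq. is_minimal_pair \<alpha> pq)"

text \<open>For algebraic \<open>\<alpha>\<close> both definite descriptions are well-defined.\<close>

lemma ex1_is_min_poly:
  assumes "algebraic \<alpha>"
  shows "\<exists>!m. is_min_poly \<alpha> m"
proof -
  define P where "P = (\<lambda>g :: rat poly. g \<noteq> 0 \<and> poly (map_poly of_rat g) \<alpha> = 0)"
  from assms obtain h :: "real poly" where
    h: "\<And>i. coeff h i \<in> \<int>" "h \<noteq> 0" "poly h \<alpha> = 0"
    by (elim algebraicE) blast
  define g :: "rat poly" where "g = map_poly (\<lambda>x. of_int \<lfloor>x\<rfloor>) h"
  have gh: "map_poly of_rat g = h"
    using h(1) by (auto simp: g_def poly_eq_iff coeff_map_poly of_int_floor)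
  have "P g"
    using gh h by (auto simp: P_def)
  then obtain m0 where m0: "P m0" "\<And>g. P g \<Longrightarrow> degree m0 \<le> degree g"
    using ex_has_least_nat[of P g degree] by blast
  define m where "m = smult (inverse (lead_coeff m0)) m0"
  have of_rat_smult: "map_poly of_rat (smult c f) = smult (of_rat c) (map_poly of_rat f :: real poly)"
    for c f by (simp add: poly_eq_iff coeff_map_poly of_rat_mult)
  have "is_min_poly \<alpha> m"
    using m0 by (auto simp: is_min_poly_def m_def P_def of_rat_smult)
  moreover have "a = b" if a: "is_min_poly \<alpha> a" and b: "is_min_poly \<alpha> b" for a b
  proof (rule ccontr)
    assume "a \<noteq> b"
    have nz: "a \<noteq> 0" "b \<noteq> 0"
      using a b by (auto simp: is_min_poly_def)
    have deg: "degree a = degree b"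
      using a b nz by (metis is_min_poly_def order_antisym)
    have "map_poly of_rat (a - b) = map_poly of_rat a - (map_poly of_rat b :: real poly)"
      by (simp add: poly_eq_iff coeff_map_poly of_rat_diff)
    then have "poly (map_poly of_rat (a - b)) \<alpha> = 0"
      using a b by (simp add: is_min_poly_def)
    then have le: "degree a \<le> degree (a - b)"
      using a \<open>a \<noteq> b\<close> by (auto simp: is_min_poly_def)
    have "degree (a - b) \<le> degree a"
      using deg by (simp add: degree_diff_le)
    with le have "degree (a - b) = degree a" by simp
    then have "lead_coeff (a - b) = lead_coeff a - lead_coeff b"
      using deg by simp
    also have "\<dots> = 0"
      using a b by (simp add: is_min_poly_def)
    finally show False
      using \<open>a \<noteq> b\<close> by (metis leading_coeff_0_iff right_minus_eq)
  qed
  ultimately show ?thesis by blast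
qed

lemma is_min_poly_min_poly: "algebraic \<alpha> \<Longrightarrow> is_min_poly \<alpha> (min_poly \<alpha>)"
  unfolding min_poly_def by (rule theI') (rule ex1_is_min_poly)

lemma clear_denominators:
  fixes m :: "rat poly"
  shows "\<exists>(c::int) (G::int poly). c > 0 \<and> map_poly of_int G = smult (of_int c) m"
proof (induction m)
  case 0
  show ?case by (intro exI[of _ 1] exI[of _ 0]) simp
next
  case (pCons a m)
  then obtain c :: int and G :: "int poly"
    where c: "c > 0" "map_poly of_int G = smult (of_int c) m" by blast
  obtain u v :: int where uv: "a = of_int u / of_int v" "v > 0"
    by (metis quotient_of_denom_pos quotient_of_div surj_pair)
  have "map_poly of_int (smult v G) = smult (of_int v) (map_poly of_int G :: rat poly)"
    by (simp add: poly_eq_iff coeff_map_poly)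
  then have "map_poly of_int (pCons (c * u) (smult v G)) = smult (of_int (v * c)) (pCons a m)"
    using c uv by (simp add: map_poly_pCons)
  then show ?case
    using c uv by (intro exI[of _ "v * c"] exI[of _ "pCons (c * u) (smult v G)"]) simp
qed

lemma ex1_is_minimal_pair:
  assumes "algebraic \<alpha>"
  shows "\<exists>!pq. is_minimal_pair \<alpha> pq"
proof -
  define m where "m = min_poly \<alpha>"
  have m: "lead_coeff m = 1"
    using is_min_poly_min_poly[OF assms] by (simp add: m_def is_min_poly_def)
  obtain c :: int and G :: "int poly"
    where G: "c > 0" "map_poly of_int G = smult (of_int c) m"
    using clear_denominators by blast
  define F where "F = primitive_part G"
  have "G \<noteq> 0"
    using G m by auto
  then have F1: "content F = 1" and k: "content G > 0"
    by (auto simp: F_def order_less_le) (metis abs_ge_zero normalize_content normalize_int_def)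
  have GF: "G = smult (content G) F"
    by (simp add: F_def)
  have coeffG: "of_int (content G) * of_int (coeff F i) = of_int c * coeff m i" for i
  proof -
    have "of_int (coeff G i) = of_int c * coeff m i"
      using arg_cong[OF G(2), of "\<lambda>f. coeff f i"] by (simp add: coeff_map_poly)
    then show ?thesis
      using arg_cong[OF GF, of "\<lambda>f. coeff f i"] by (metis coeff_smult of_int_mult)
  qed
  define l where "l = coeff F (degree m)"
  have cl: "of_int (content G) * of_int l = (of_int c :: rat)"
    using coeffG[of "degree m"] m by (simp add: l_def)
  then have "content G * l = c"
    by (metis of_int_eq_iff of_int_mult)
  then have l: "l > 0"
    using G(1) k by (metis zero_less_mult_pos)
  have "of_int (coeff F i) = of_int l * coeff m i" for i
  proof -
    have "of_int (content G) * of_int (coeff F i) = of_int (content G) * (of_int l * coeff m i)"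
      using coeffG[of i] cl by (simp add: mult.assoc [symmetric])
    then show ?thesis using k \<open>G \<noteq> 0\<close> by simp
  qed
  then have Fm: "map_poly of_int F = smult (of_nat (nat l)) m"
    using l by (simp add: poly_eq_iff coeff_map_poly)
  define p where "p = map_poly nat F"
  define q where "q = map_poly nat (- F)"
  have "F = map_poly int p - map_poly int q"
    by (simp add: p_def q_def poly_eq_iff coeff_map_poly)
  moreover have "{i. coeff p i \<noteq> 0} \<inter> {i. coeff q i \<noteq> 0} = {}"
    by (auto simp: p_def q_def coeff_map_poly)
  ultimately have "is_minimal_pair \<alpha> (p, q)"
    using l F1 Fm unfolding is_minimal_pair_def m_def prod.case
    by (intro exI[of _ "nat l"] exI[of _ F]) simp
  moreover have "pq = (p, q)" if mp: "is_minimal_pair \<alpha> pq" for pq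
  proof -
    obtain p' q' where pq: "pq = (p', q')" by (cases pq)
    obtain l' :: nat and F' where *: "l' > 0" "map_poly of_int F' = smult (of_nat l') m"
      "content F' = 1" "F' = map_poly int p' - map_poly int q'"
      "{i. coeff p' i \<noteq> 0} \<inter> {i. coeff q' i \<noteq> 0} = {}"
      using mp unfolding pq is_minimal_pair_def m_def prod.case by blast
    have eq: "smult (int l') F = smult l F'"
    proof (rule poly_eqI)
      fix i
      have "of_int (coeff F i) = of_int l * coeff m i" "of_int (coeff F' i) = of_nat l' * coeff m i"
        using arg_cong[OF Fm, of "\<lambda>f. coeff f i"] arg_cong[OF *(2), of "\<lambda>f. coeff f i"] l
        by (simp_all add: coeff_map_poly)
      then have "(of_int (int l' * coeff F i) :: rat) = of_int (l * coeff F' i)"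
        by simp
      then show "coeff (smult (int l') F) i = coeff (smult l F') i"
        by (simp only: of_int_eq_iff coeff_smult)
    qed
    have "normalize (int l') * content F = normalize l * content F'"
      using arg_cong[OF eq, of content] by (simp only: content_smult)
    then have "int l' = l"
      using F1 *(3) l by simp
    then have "l * coeff F i = l * coeff F' i" for i
      using arg_cong[OF eq, of "\<lambda>f. coeff f i"] by (simp only: coeff_smult)
    then have "F' = F"
      using l by (simp add: poly_eq_iff)
    have "coeff p' i = nat (coeff F i) \<and> coeff q' i = nat (- coeff F i)" for i
    proof -
      have "coeff F i = int (coeff p' i) - int (coeff q' i)"
        using *(4) \<open>F' = F\<close> by (simp add: coeff_map_poly)
      moreover have "coeff p' i = 0 \<or> coeff q' i = 0"
        using *(5) by blast
      ultimately show ?thesis by auto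
    qed
    then show ?thesis
      by (simp add: pq p_def q_def poly_eq_iff coeff_map_poly)
  qed
  ultimately show ?thesis by blast
qed

lemma is_minimal_pair_minimal_pair: "algebraic \<alpha> \<Longrightarrow> is_minimal_pair \<alpha> (minimal_pair \<alpha>)"
  unfolding minimal_pair_def by (rule theI') (rule ex1_is_minimal_pair)

end

theory Submission
  imports Defs
begin

text \<open>
  The powers of \<open>\<alpha>\<close> generate the monoid, so every atom is a power of \<open>\<alpha>\<close>. If \<open>\<alpha>\<close> is transcendental,
  or if \<open>p = X\<^sup>n\<close>, the monoid is free on all powers of \<open>\<alpha>\<close>, respectively on those with exponent below
  \<open>n = d\<close>.

  Conversely, let \<open>\<alpha> \<noteq> 1\<close> be algebraic and \<open>1\<close> an atom. If a power \<open>\<alpha>\<^sup>k\<close> with \<open>k \<le> d\<close> is not an atom,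
  then it is a combination of lower powers with coefficients in the natural numbers; this is a monic
  relation of degree at most \<open>d\<close>, hence the minimal polynomial, and \<open>p = X\<^sup>k\<close>. If \<open>\<alpha>\<^sup>0, \<dots>, \<alpha>\<^sup>d\<close> are all
  atoms, there are more than \<open>d\<close> atoms, and \<open>p\<close> and \<open>q\<close> are two factorizations of the same element; equal
  lengths would mean \<open>p(1) = q(1)\<close>, so \<open>1\<close> would be a root of the minimal polynomial and \<open>\<alpha> = 1\<close>.
\<close>


section \<open>Generators, atoms and free monoids\<close>

lemma add_submonoid_Inter:
  "(\<And>M. M \<in> \<M> \<Longrightarrow> add_submonoid M) \<Longrightarrow> add_submonoid (\<Inter>\<M>)"
  unfolding add_submonoid_def by blast

lemma add_submonoid_hull: "add_submonoid (add_submonoid hull B)"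
  by (rule hull_in) (simp add: add_submonoid_Inter)

lemma sum_mset_in_add_submonoid:
  "add_submonoid M \<Longrightarrow> set_mset z \<subseteq> M \<Longrightarrow> sum_mset z \<in> M"
  by (induction z) (auto simp: add_submonoid_def)

lemma add_submonoid_hull_eq: "add_submonoid hull B = sum_mset ` {z. set_mset z \<subseteq> B}"
proof (rule hull_unique)
  show "B \<subseteq> sum_mset ` {z. set_mset z \<subseteq> B}"
  proof
    fix b assume "b \<in> B"
    then show "b \<in> sum_mset ` {z. set_mset z \<subseteq> B}"
      by (intro image_eqI[of _ _ "{#b#}"]) auto
  qed
  have "sum_mset z + sum_mset w \<in> sum_mset ` {z. set_mset z \<subseteq> B}"
    if "set_mset z \<subseteq> B" "set_mset w \<subseteq> B" for z w
    using that by (intro image_eqI[of _ _ "z + w"]) auto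
  moreover have "0 \<in> sum_mset ` {z. set_mset z \<subseteq> B}"
    by (intro image_eqI[of _ _ "{#}"]) auto
  ultimately show "add_submonoid (sum_mset ` {z. set_mset z \<subseteq> B})"
    unfolding add_submonoid_def by auto
  show "sum_mset ` {z. set_mset z \<subseteq> B} \<subseteq> M" if "B \<subseteq> M" "add_submonoid M" for M
    using that sum_mset_in_add_submonoid by blast
qed

lemma sum_mset_in_atoms:
  assumes "add_submonoid M" "set_mset z \<subseteq> M" "sum_mset z \<in> atoms M"
  shows "sum_mset z \<in># z"
  using assms(2,3)
proof (induction z)
  case empty
  then show ?case by (simp add: atoms_def)
next
  case (add g z)
  have "g \<in> M" "sum_mset z \<in> M"
    using add.prems assms(1) sum_mset_in_add_submonoid by auto
  then consider "g = 0" | "sum_mset z = 0"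
    using add.prems(2) unfolding atoms_def by auto
  then show ?case
    using add by cases auto
qed

lemma atoms_subset_generators:
  assumes "add_submonoid hull B = M"
  shows "atoms M \<subseteq> B"
proof
  fix a assume a: "a \<in> atoms M"
  have M: "add_submonoid M" "B \<subseteq> M"
    using assms add_submonoid_hull[of B] hull_subset[of B add_submonoid] by auto
  obtain z where z: "set_mset z \<subseteq> B" "a = sum_mset z"
    using a assms unfolding atoms_def add_submonoid_hull_eq by blast
  then have "sum_mset z \<in># z"
    using M a by (intro sum_mset_in_atoms[of M]) auto
  then show "a \<in> B" using z by auto
qed

text \<open>The atoms generate by atomicity, and they lie in every generating set.\<close>

lemma finitely_generated_iff_finite_atoms:
  assumes "atomic M"
  shows "finitely_generated M \<longleftrightarrow> finite (atoms M)"
  using assms atoms_subset_generators finite_subset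
  unfolding atomic_def finitely_generated_def by metis

text \<open>The hypothesis \<open>inj\<close> expresses freeness on \<open>B\<close>. A
  decomposition of \<open>b\<close> lifts to a splitting of the one-element multiset
  \<open>{#b#}\<close>, in which one part is empty.\<close>

lemma free_monoid_atoms:
  assumes gen: "add_submonoid hull B = M"
    and inj: "inj_on sum_mset {z. set_mset z \<subseteq> B}"
  shows "atoms M = B"
proof
  show "atoms M \<subseteq> B"
    using gen by (rule atoms_subset_generators)
  show "B \<subseteq> atoms M"
  proof
    fix b assume b: "b \<in> B"
    then have "b \<in> M" using gen hull_inc[of b B add_submonoid] by simp
    moreover have "b \<noteq> 0"
      using inj_onD[OF inj, of "{#b#}" "{#}"] b by auto
    moreover have "x = 0 \<or> y = 0" if "x \<in> M" "y \<in> M" "b = x + y" for x y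
    proof -
      obtain z w where zw: "set_mset z \<subseteq> B" "x = sum_mset z" "set_mset w \<subseteq> B" "y = sum_mset w"
        using \<open>x \<in> M\<close> \<open>y \<in> M\<close> gen unfolding add_submonoid_hull_eq by blast
      then have "{#b#} = z + w"
        using b \<open>b = x + y\<close> by (intro inj_onD[OF inj]) auto
      then have "z = {#} \<or> w = {#}"
        by (metis add_mset_eq_single single_is_union)
      then show ?thesis using zw by auto
    qed
    ultimately show "b \<in> atoms M" unfolding atoms_def by blast
  qed
qed

lemma free_monoid_UFM:
  assumes gen: "add_submonoid hull B = M"
    and inj: "inj_on sum_mset {z. set_mset z \<subseteq> B}"
  shows "UFM M"
proof -
  have A: "atoms M = B" using assms by (rule free_monoid_atoms)
  have "\<exists>!z. z \<in> factorizations M x" if "x \<in> M" for x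
  proof -
    have "\<exists>z. z \<in> factorizations M x"
      using that gen unfolding factorizations_def A add_submonoid_hull_eq by blast
    moreover have "z = w" if "z \<in> factorizations M x" "w \<in> factorizations M x" for z w
      using that inj unfolding factorizations_def A inj_on_def by blast
    ultimately show ?thesis by blast
  qed
  then show ?thesis using gen by (simp add: UFM_def atomic_def A)
qed

lemma UFM_imp_HFM: "UFM M \<Longrightarrow> HFM M"
  unfolding UFM_def HFM_def by metis

text \<open>The elements that \<open>c\<close> multiplies into the hull form a submonoid, so it
  suffices to test generators. With \<open>c = \<alpha>\<close> this yields closure under
  multiplication by \<alpha>.\<close>

lemma add_submonoid_scale_hull:
  fixes c :: "'a::semiring_0_cancel"
  assumes "\<And>b. b \<in> B \<Longrightarrow> c * b \<in> add_submonoid hull B" "x \<in> add_submonoid hull B"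
  shows "c * x \<in> add_submonoid hull B"
  using assms(2)
proof (rule hull_induct)
  show "add_submonoid {x. c * x \<in> add_submonoid hull B}"
    using add_submonoid_hull[of B] by (auto simp: add_submonoid_def distrib_left)
qed (rule assms(1))


section \<open>Powers of \<open>\<alpha>\<close> as generators\<close>

lemma poly_of_nat_eq_sum:
  assumes "\<And>i. i \<ge> n \<Longrightarrow> coeff f i = 0"
  shows "poly (map_poly of_nat f) (\<alpha>::real) = (\<Sum>i<n. of_nat (coeff f i) * \<alpha> ^ i)"
proof -
  have "poly (map_poly of_nat f) \<alpha> = (\<Sum>i\<le>degree f. of_nat (coeff f i) * \<alpha> ^ i)"
    by (simp add: poly_altdef coeff_map_poly degree_map_poly)
  also have "\<dots> = (\<Sum>i<n. of_nat (coeff f i) * \<alpha> ^ i)"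
    by (intro sum.mono_neutral_cong) (auto simp: assms coeff_eq_0 not_less not_le)
  finally show ?thesis .
qed

lemma of_nat_mult_in_add_submonoid:
  fixes x :: "'a::semiring_1_cancel"
  shows "add_submonoid M \<Longrightarrow> x \<in> M \<Longrightarrow> of_nat k * x \<in> M"
  by (induction k) (auto simp: add_submonoid_def distrib_right)

lemma sum_in_add_submonoid:
  "add_submonoid M \<Longrightarrow> (\<And>i. i \<in> I \<Longrightarrow> f i \<in> M) \<Longrightarrow> sum f I \<in> M"
  by (induction I rule: infinite_finite_induct) (auto simp: add_submonoid_def)

lemma poly_in_add_submonoid:
  assumes "add_submonoid M" "\<And>i. coeff f i \<noteq> 0 \<Longrightarrow> (\<alpha>::real) ^ i \<in> M"
  shows "poly (map_poly of_nat f) \<alpha> \<in> M"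
proof -
  have "of_nat (coeff f i) * \<alpha> ^ i \<in> M" for i
    using assms of_nat_mult_in_add_submonoid[of M "\<alpha> ^ i" "coeff f i"]
    by (cases "coeff f i = 0") (auto simp: add_submonoid_def)
  then show ?thesis
    using assms(1) by (auto simp: poly_altdef coeff_map_poly intro!: sum_in_add_submonoid)
qed

lemma power_in_nat_adjoin: "\<alpha> ^ i \<in> nat_adjoin \<alpha>"
  unfolding nat_adjoin_def
  by (rule CollectI, rule exI[of _ "monom 1 i"]) (simp add: map_poly_monom poly_monom)

lemma nat_adjoin_eq_hull: "nat_adjoin \<alpha> = add_submonoid hull range ((^) \<alpha>)"
proof (rule hull_unique[symmetric])
  show "range ((^) \<alpha>) \<subseteq> nat_adjoin \<alpha>" using power_in_nat_adjoin by blast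
  show "nat_adjoin \<alpha> \<subseteq> M" if "range ((^) \<alpha>) \<subseteq> M" "add_submonoid M" for M
    using that poly_in_add_submonoid unfolding nat_adjoin_def by blast
qed (rule add_submonoid_nat_adjoin)

lemma mult_in_nat_adjoin: "x \<in> nat_adjoin \<alpha> \<Longrightarrow> \<alpha> * x \<in> nat_adjoin \<alpha>"
  unfolding nat_adjoin_eq_hull
  by (rule add_submonoid_scale_hull) (auto intro!: hull_inc simp flip: power_Suc)

text \<open>Linear independence over the integers, equivalently over the rationals. The family is
  indexed by exponents, not by values, so distinct exponents in \<open>D\<close> must give distinct
  powers.\<close>

definition powers_independent :: "real \<Rightarrow> nat set \<Rightarrow> bool" where
  "powers_independent \<alpha> D \<longleftrightarrow>
     (\<forall>f :: int poly. (\<forall>i. i \<notin> D \<longrightarrow> coeff f i = 0) \<and> poly (map_poly of_int f) \<alpha> = 0 \<longrightarrow> f = 0)"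

lemma coeff_sum_mset_monom: "coeff (\<Sum>i\<in>#w. monom (1::int) i) j = int (count w j)"
  by (induction w) auto

lemma poly_sum_mset_monom:
  "poly (map_poly of_int (\<Sum>i\<in>#w. monom (1::int) i)) (\<alpha>::real) = (\<Sum>i\<in>#w. \<alpha> ^ i)"
proof (induction w)
  case (add i w)
  have "map_poly of_int (monom 1 i + f) = monom 1 i + (map_poly of_int f :: real poly)" for f
    by (simp add: poly_eq_iff coeff_map_poly)
  then show ?case using add by (simp add: poly_monom)
qed simp

text \<open>A multiset of exponents is encoded as the integer polynomial whose coefficients are the
  multiplicities. Equal sums of powers make \<alpha> a root of the difference of two such
  polynomials.\<close>

lemma powers_independentD:
  assumes "powers_independent \<alpha> D" "set_mset v \<subseteq> D" "set_mset w \<subseteq> D"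
    "(\<Sum>i\<in>#v. \<alpha> ^ i) = (\<Sum>i\<in>#w. \<alpha> ^ i)"
  shows "v = w"
proof -
  define P where "P = (\<lambda>w. \<Sum>i\<in>#w. monom (1::int) i)"
  have "map_poly of_int (P v - P w) = map_poly of_int (P v) - (map_poly of_int (P w) :: real poly)"
    by (simp add: poly_eq_iff coeff_map_poly)
  then have "poly (map_poly of_int (P v - P w)) \<alpha> = 0"
    using assms(4) by (simp add: P_def poly_sum_mset_monom)
  moreover have "coeff (P v - P w) i = 0" if "i \<notin> D" for i
    using that assms(2,3) count_eq_zero_iff[of v i] count_eq_zero_iff[of w i]
    by (auto simp: P_def coeff_sum_mset_monom)
  ultimately have "P v - P w = 0"
    using assms(1) unfolding powers_independent_def by blast
  then have "coeff (P v) i = coeff (P w) i" for i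
    by simp
  then show ?thesis
    by (simp add: multiset_eq_iff P_def coeff_sum_mset_monom)
qed

lemma inj_on_power_of_independent:
  assumes "powers_independent \<alpha> D"
  shows "inj_on ((^) \<alpha>) D"
proof (rule inj_onI)
  fix i j assume "i \<in> D" "j \<in> D" "\<alpha> ^ i = \<alpha> ^ j"
  then have "{#i#} = {#j#}" by (intro powers_independentD[OF assms]) auto
  then show "i = j" by simp
qed

lemma inj_on_sum_mset_of_independent:
  assumes "powers_independent \<alpha> D"
  shows "inj_on sum_mset {z. set_mset z \<subseteq> (^) \<alpha> ` D}"
proof (rule inj_onI)
  \<comment> \<open>Multisets of powers are lifted to multisets of exponents, where independence
    applies.\<close>
  have *: "\<exists>w. set_mset w \<subseteq> D \<and> z = image_mset ((^) \<alpha>) w" if "set_mset z \<subseteq> (^) \<alpha> ` D" for z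
    using that
  proof (induction z)
    case (add x z)
    then obtain w i where "set_mset w \<subseteq> D" "z = image_mset ((^) \<alpha>) w" "i \<in> D" "x = \<alpha> ^ i"
      by auto
    then show ?case by (intro exI[of _ "add_mset i w"]) auto
  qed auto
  fix y z assume "y \<in> {z. set_mset z \<subseteq> (^) \<alpha> ` D}" "z \<in> {z. set_mset z \<subseteq> (^) \<alpha> ` D}"
    and eq: "sum_mset y = sum_mset z"
  then obtain v w where "set_mset v \<subseteq> D" "y = image_mset ((^) \<alpha>) v"
    "set_mset w \<subseteq> D" "z = image_mset ((^) \<alpha>) w"
    using * by blast
  then show "y = z" using powers_independentD[OF assms, of v w] eq by simp
qed

lemma nat_adjoin_free:
  assumes "powers_independent \<alpha> D" "nat_adjoin \<alpha> = add_submonoid hull ((^) \<alpha> ` D)"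
  shows "UFM (nat_adjoin \<alpha>)" "atoms (nat_adjoin \<alpha>) = (^) \<alpha> ` D"
  using assms free_monoid_UFM free_monoid_atoms inj_on_sum_mset_of_independent by metis+

section \<open>Transcendental \<alpha>\<close>

lemma transcendental_powers_independent:
  assumes "\<not> algebraic \<alpha>"
  shows "powers_independent \<alpha> UNIV"
  unfolding powers_independent_def
proof (intro allI impI)
  fix f :: "int poly"
  assume f: "(\<forall>i. i \<notin> UNIV \<longrightarrow> coeff f i = 0) \<and> poly (map_poly of_int f) \<alpha> = 0"
  show "f = 0"
  proof (rule ccontr)
    assume "f \<noteq> 0"
    then have "algebraic \<alpha>"
      using f by (intro algebraicI[of "map_poly of_int f"]) (auto simp: coeff_map_poly poly_eq_iff)
    with assms show False by simp
  qed
qed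

lemma transcendental_UFM:
  assumes "\<not> algebraic \<alpha>"
  shows "UFM (nat_adjoin \<alpha>)" "\<not> finitely_generated (nat_adjoin \<alpha>)"
proof -
  note ind = transcendental_powers_independent[OF assms]
  note free = nat_adjoin_free[OF ind nat_adjoin_eq_hull]
  show "UFM (nat_adjoin \<alpha>)" by (rule free)
  have "infinite (atoms (nat_adjoin \<alpha>))"
    unfolding free(2) using inj_on_power_of_independent[OF ind] finite_imageD infinite_UNIV_nat by blast
  then show "\<not> finitely_generated (nat_adjoin \<alpha>)"
    using free(1) finitely_generated_iff_finite_atoms unfolding UFM_def by blast
qed


section \<open>Algebraic \<open>\<alpha>\<close>\<close>

lemma min_poly_props:
  assumes "algebraic \<alpha>"
  shows "lead_coeff (min_poly \<alpha>) = 1" "poly (map_poly of_rat (min_poly \<alpha>)) \<alpha> = 0"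
    "\<And>g. g \<noteq> 0 \<Longrightarrow> poly (map_poly of_rat g) \<alpha> = 0 \<Longrightarrow> degree (min_poly \<alpha>) \<le> degree g"
  using is_min_poly_min_poly[OF assms] unfolding is_min_poly_def by auto

lemma degree_min_poly_pos:
  assumes "algebraic \<alpha>"
  shows "degree (min_poly \<alpha>) > 0"
proof (rule ccontr)
  assume "\<not> degree (min_poly \<alpha>) > 0"
  then obtain c where "min_poly \<alpha> = [:c:]"
    by (metis degree_eq_zeroE gr0I)
  then show False using min_poly_props[OF assms] by (auto simp: map_poly_pCons split: if_splits)
qed

text \<open>If \<open>X - 1\<close> divides the minimal polynomial and
  \<open>\<alpha> \<noteq> 1\<close>, then the cofactor vanishes at \<alpha> and has smaller
  degree.\<close>

lemma min_poly_root_one: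
  assumes "algebraic \<alpha>" "poly (min_poly \<alpha>) 1 = 0"
  shows "\<alpha> = 1"
proof (rule ccontr)
  assume "\<alpha> \<noteq> 1"
  obtain h where h: "min_poly \<alpha> = [:-1, 1:] * h"
    using assms(2) by (auto simp: poly_eq_0_iff_dvd dvd_def)
  have "h \<noteq> 0" using h min_poly_props(1)[OF assms(1)] by auto
  have "map_poly of_rat (pCons 0 h - h) = pCons 0 (map_poly of_rat h) - (map_poly of_rat h :: real poly)"
    by (simp add: poly_eq_iff coeff_map_poly coeff_pCons of_rat_diff split: nat.splits)
  moreover have "min_poly \<alpha> = pCons 0 h - h" using h by simp
  ultimately have "(\<alpha> - 1) * poly (map_poly of_rat h) \<alpha> = 0"
    using min_poly_props(2)[OF assms(1)] by (simp add: left_diff_distrib)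
  then have "degree (min_poly \<alpha>) \<le> degree h"
    using \<open>\<alpha> \<noteq> 1\<close> \<open>h \<noteq> 0\<close> by (intro min_poly_props(3)[OF assms(1)]) auto
  then show False using \<open>h \<noteq> 0\<close> h by (simp add: degree_mult_eq del: mult_pCons_left)
qed

text \<open>A nontrivial relation would be a polynomial of degree below that of the minimal
  polynomial with root \<alpha>.\<close>

lemma algebraic_powers_independent:
  assumes "algebraic \<alpha>"
  shows "powers_independent \<alpha> {..<degree (min_poly \<alpha>)}"
  unfolding powers_independent_def
proof (intro allI impI)
  fix f :: "int poly"
  assume f: "(\<forall>i. i \<notin> {..<degree (min_poly \<alpha>)} \<longrightarrow> coeff f i = 0) \<and> poly (map_poly of_int f) \<alpha> = 0"
  show "f = 0"
  proof (rule ccontr)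
    assume "f \<noteq> 0"
    define g :: "rat poly" where "g = map_poly of_int f"
    have "map_poly of_rat g = (map_poly of_int f :: real poly)"
      by (simp add: g_def poly_eq_iff coeff_map_poly)
    moreover have "g \<noteq> 0" using \<open>f \<noteq> 0\<close> by (auto simp: g_def poly_eq_iff coeff_map_poly)
    ultimately have "degree (min_poly \<alpha>) \<le> degree g"
      using f by (intro min_poly_props(3)[OF assms]) auto
    also have "degree g = degree f" by (simp add: g_def degree_map_poly)
    finally have "lead_coeff f = 0" using f by auto
    with \<open>f \<noteq> 0\<close> show False by simp
  qed
qed

section \<open>The minimal pair: coefficients and values\<close>

lemma minimal_pairE:
  assumes "algebraic \<alpha>" "minimal_pair \<alpha> = (p, q)"
  obtains l :: nat where "l > 0"
    "\<And>i. of_nat l * coeff (min_poly \<alpha>) i = of_nat (coeff p i) - of_nat (coeff q i)"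
    "\<And>i. coeff p i = 0 \<or> coeff q i = 0"
proof -
  obtain l :: nat and F :: "int poly" where *: "l > 0"
    "map_poly of_int F = smult (of_nat l) (min_poly \<alpha>)" "F = map_poly int p - map_poly int q"
    "{i. coeff p i \<noteq> 0} \<inter> {i. coeff q i \<noteq> 0} = {}"
    using is_minimal_pair_minimal_pair[OF assms(1)] assms(2) unfolding is_minimal_pair_def by auto
  show thesis
  proof (rule that[of l])
    fix i
    show "of_nat l * coeff (min_poly \<alpha>) i = of_nat (coeff p i) - of_nat (coeff q i)"
      using arg_cong[OF *(2), of "\<lambda>f. coeff f i"] by (simp add: *(3) coeff_map_poly)
    show "coeff p i = 0 \<or> coeff q i = 0" using *(4) by blast
  qed (rule *(1))
qed

text \<open>Above the degree the coefficients of \<open>p\<close> and \<open>q\<close> agree; as the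
  supports are disjoint, both vanish.\<close>

lemma minimal_pair_coeff_eq_0:
  assumes "algebraic \<alpha>" "minimal_pair \<alpha> = (p, q)" "i > degree (min_poly \<alpha>)"
  shows "coeff p i = 0" "coeff q i = 0"
proof -
  obtain l :: nat where "of_nat l * coeff (min_poly \<alpha>) i = of_nat (coeff p i) - of_nat (coeff q i)"
    "coeff p i = 0 \<or> coeff q i = 0"
    using minimal_pairE[OF assms(1,2)] by metis
  then show "coeff p i = 0" "coeff q i = 0"
    using assms(3) by (auto simp: coeff_eq_0)
qed

lemma minimal_pair_eval_eq:
  assumes "algebraic \<alpha>" "minimal_pair \<alpha> = (p, q)"
  shows "poly (map_poly of_nat p) \<alpha> = poly (map_poly of_nat q) \<alpha>"
proof -
  obtain l :: nat where l:
    "\<And>i. of_nat l * coeff (min_poly \<alpha>) i = of_nat (coeff p i) - of_nat (coeff q i)"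
    using minimal_pairE[OF assms] by metis
  have "smult (of_nat l) (map_poly of_rat (min_poly \<alpha>)) = map_poly of_nat p - (map_poly of_nat q :: real poly)"
  proof (rule poly_eqI)
    fix i
    have "(of_rat (of_nat l * coeff (min_poly \<alpha>) i) :: real) = of_nat (coeff p i) - of_nat (coeff q i)"
      unfolding l by (simp add: of_rat_diff)
    then show "coeff (smult (of_nat l) (map_poly of_rat (min_poly \<alpha>))) i
        = coeff (map_poly of_nat p - (map_poly of_nat q :: real poly)) i"
      by (simp add: coeff_map_poly of_rat_mult)
  qed
  from arg_cong[OF this, of "\<lambda>f. poly f \<alpha>"] show ?thesis
    using min_poly_props(2)[OF assms(1)] by simp
qed

text \<open>The coefficient sums are the values at 1, so their equality makes 1 a root of the
  minimal polynomial.\<close>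

lemma minimal_pair_sum_coeff_eq:
  assumes "algebraic \<alpha>" "minimal_pair \<alpha> = (p, q)"
    "(\<Sum>i\<le>degree (min_poly \<alpha>). coeff p i) = (\<Sum>i\<le>degree (min_poly \<alpha>). coeff q i)"
  shows "\<alpha> = 1"
proof -
  obtain l :: nat where l: "l > 0"
    "\<And>i. of_nat l * coeff (min_poly \<alpha>) i = of_nat (coeff p i) - of_nat (coeff q i)"
    using minimal_pairE[OF assms(1,2)] by metis
  have "of_nat l * poly (min_poly \<alpha>) 1 = (\<Sum>i\<le>degree (min_poly \<alpha>). of_nat (coeff p i) - of_nat (coeff q i))"
    by (simp add: poly_altdef sum_distrib_left l(2))
  also have "\<dots> = of_nat (\<Sum>i\<le>degree (min_poly \<alpha>). coeff p i) - of_nat (\<Sum>i\<le>degree (min_poly \<alpha>). coeff q i)"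
    by (simp add: sum_subtractf)
  also have "\<dots> = 0" using assms(3) by simp
  finally show ?thesis using l(1) min_poly_root_one[OF assms(1)] by simp
qed

text \<open>The relation \<open>\<alpha> ^ d = q(\<alpha>)\<close> expresses
  \<open>\<alpha> ^ d\<close> by lower powers. Hence the first \<open>d\<close> powers generate a
  submonoid closed under multiplication by \<alpha>, which is everything, and their independence
  makes it free.\<close>

lemma minimal_pair_monom_free:
  assumes "algebraic \<alpha>" "minimal_pair \<alpha> = (monom 1 n, q)"
  shows "UFM (nat_adjoin \<alpha>)" "finite (atoms (nat_adjoin \<alpha>))"
    "card (atoms (nat_adjoin \<alpha>)) = degree (min_poly \<alpha>)"
proof -
  define d where "d = degree (min_poly \<alpha>)"
  obtain l :: nat where l: "l > 0"
    "\<And>i. of_nat l * coeff (min_poly \<alpha>) i = of_nat (coeff (monom 1 n) i) - of_nat (coeff q i)"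
    "\<And>i. coeff (monom 1 n :: nat poly) i = 0 \<or> coeff q i = 0"
    using minimal_pairE[OF assms] by metis
  \<comment> \<open>The minimal polynomial is monic of degree \<open>d\<close>. If \<open>p\<close>
    had no term of degree \<open>d\<close>, comparing coefficients there would give
    \<open>l = - coeff q d\<close>, against \<open>l > 0\<close>.\<close>
  have n: "n = d"
  proof (rule ccontr)
    assume "n \<noteq> d"
    then have "of_nat l = - (of_nat (coeff q d) :: rat)"
      using l(2)[of d] min_poly_props(1)[OF assms(1)] by (simp add: d_def)
    moreover have "(of_nat l :: rat) > 0" using l(1) by simp
    ultimately show False by (metis neg_0_less_iff_less not_less of_nat_0_le_iff)
  qed
  \<comment> \<open>At \<open>i = d\<close> this is disjointness of the supports, above
    \<open>d\<close> the degree bound.\<close>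
  have q: "coeff q i = 0" if "i \<ge> d" for i
    using that minimal_pair_coeff_eq_0(2)[OF assms, of i] l(3)[of i] n
    by (cases "i = d") (auto simp: d_def)
  let ?H = "add_submonoid hull ((^) \<alpha> ` {..<d})"
  have low: "\<alpha> ^ i \<in> ?H" if "i < d" for i
    using that by (intro hull_inc) auto
  have "poly (map_poly of_nat q) \<alpha> \<in> ?H"
  proof (rule poly_in_add_submonoid[OF add_submonoid_hull])
    show "\<alpha> ^ i \<in> ?H" if "coeff q i \<noteq> 0" for i
      using that q[of i] low[of i] by linarith
  qed
  then have top: "\<alpha> ^ d \<in> ?H"
    using minimal_pair_eval_eq[OF assms] n by (simp add: map_poly_monom poly_monom)
  \<comment> \<open>Only the last generator leaves the list when multiplied by \<alpha>; it becomes
    \<open>\<alpha> ^ d\<close>, which is covered by \<open>top\<close>.\<close>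
  have scale: "\<alpha> * x \<in> ?H" if "x \<in> ?H" for x
  proof (rule add_submonoid_scale_hull[OF _ that])
    fix b assume "b \<in> (^) \<alpha> ` {..<d}"
    then obtain i where i: "b = \<alpha> ^ i" "i < d" by auto
    then show "\<alpha> * b \<in> ?H"
      using low[of "Suc i"] top by (cases "Suc i = d") auto
  qed
  have "\<alpha> ^ i \<in> ?H" for i
  proof (induction i)
    case 0
    show ?case using low[of 0] degree_min_poly_pos[OF assms(1)] by (simp add: d_def)
  qed (use scale in auto)
  then have "nat_adjoin \<alpha> \<subseteq> ?H"
    unfolding nat_adjoin_eq_hull by (intro hull_minimal add_submonoid_hull) auto
  moreover have "?H \<subseteq> nat_adjoin \<alpha>"
    unfolding nat_adjoin_eq_hull by (intro hull_mono) auto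
  ultimately have eq: "nat_adjoin \<alpha> = ?H" by simp
  note ind = algebraic_powers_independent[OF assms(1), folded d_def]
  note free = nat_adjoin_free[OF ind eq]
  show "UFM (nat_adjoin \<alpha>)" "finite (atoms (nat_adjoin \<alpha>))"
    "card (atoms (nat_adjoin \<alpha>)) = degree (min_poly \<alpha>)"
    using free card_image[OF inj_on_power_of_independent[OF ind]] by (simp_all add: d_def)
qed

text \<open>The polynomial \<open>X^k - f\<close> is monic, vanishes at \<alpha> and has degree at
  most that of the minimal polynomial, so it equals it. It is already integral and primitive, whence
  \<open>l = 1\<close>, and \<open>f\<close> lives below \<open>k\<close>, whence disjoint
  supports.\<close>

lemma minimal_pair_of_monic_relation:
  assumes "algebraic \<alpha>" "k \<le> degree (min_poly \<alpha>)"
    "\<And>i. i \<ge> k \<Longrightarrow> coeff f i = 0" "\<alpha> ^ k = poly (map_poly of_nat f) \<alpha>"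
  shows "minimal_pair \<alpha> = (monom 1 k, f)"
proof -
  define F :: "int poly" where "F = monom 1 k - map_poly int f"
  define G :: "rat poly" where "G = map_poly of_int F"
  have cF: "coeff F i = (if i = k then 1 else 0) - int (coeff f i)" for i
    by (simp add: F_def coeff_map_poly)
  have deg: "degree F = k"
    using assms(3) by (intro antisym degree_le le_degree) (auto simp: cF)
  have lead: "lead_coeff F = 1" using assms(3) by (simp add: deg cF)
  have dG: "degree G = k" "lead_coeff G = 1"
    using lead deg by (simp_all add: G_def coeff_map_poly degree_map_poly)
  have "map_poly of_rat G = monom 1 k - (map_poly of_nat f :: real poly)"
    by (simp add: poly_eq_iff G_def F_def coeff_map_poly of_rat_diff of_rat_minus)
  then have "poly (map_poly of_rat G) \<alpha> = 0"
    using assms(4) by (simp add: poly_monom)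
  then have "is_min_poly \<alpha> G"
    using dG assms(2) by (auto simp: is_min_poly_def intro: order_trans min_poly_props(3)[OF assms(1)])
  then have "min_poly \<alpha> = G"
    using ex1_is_min_poly[OF assms(1)] is_min_poly_min_poly[OF assms(1)] by blast
  moreover have "content F = 1"
  proof -
    \<comment> \<open>The content divides the leading coefficient, which is 1.\<close>
    have "content F dvd 1" using content_dvd_coeff[of F k] unfolding lead[unfolded deg] .
    then have "normalize (content F) = 1" by (rule is_unit_normalize)
    then show ?thesis by (simp only: normalize_content)
  qed
  moreover have "map_poly int (monom 1 k) = monom 1 k"
    by (simp add: map_poly_monom)
  ultimately have "is_minimal_pair \<alpha> (monom 1 k, f)"
    unfolding is_minimal_pair_def prod.case
    using assms(3) by (intro exI[of _ 1] exI[of _ F]) (auto simp: F_def G_def)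
  then show ?thesis
    using ex1_is_minimal_pair[OF assms(1)] is_minimal_pair_minimal_pair[OF assms(1)] by blast
qed


section \<open>Which powers of \<open>\<alpha>\<close> are atoms\<close>

text \<open>Multiplying a decomposition of 1 by \<open>\<alpha> ^ n\<close> gives a decomposition of
  \<open>\<alpha> ^ n\<close>.\<close>

lemma power_atom_imp_one_atom:
  assumes "\<alpha> > 0" "\<alpha> ^ n \<in> atoms (nat_adjoin \<alpha>)"
  shows "1 \<in> atoms (nat_adjoin \<alpha>)"
proof -
  have scale: "\<alpha> ^ n * x \<in> nat_adjoin \<alpha>" if "x \<in> nat_adjoin \<alpha>" for x
    using that by (induction n) (auto intro: mult_in_nat_adjoin simp: mult.assoc)
  have "x = 0 \<or> y = 0" if "x \<in> nat_adjoin \<alpha>" "y \<in> nat_adjoin \<alpha>" "1 = x + y" for x y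
  proof -
    have "\<alpha> ^ n = \<alpha> ^ n * x + \<alpha> ^ n * y"
      using that(3) by (metis distrib_left mult.right_neutral)
    then have "\<alpha> ^ n * x = 0 \<or> \<alpha> ^ n * y = 0"
      using assms(2) scale that(1,2) unfolding atoms_def by blast
    then show ?thesis using assms(1) by simp
  qed
  then show ?thesis
    using power_in_nat_adjoin[of \<alpha> 0] by (auto simp: atoms_def)
qed

lemma one_atom_of_atoms_nonempty:
  assumes "\<alpha> > 0" "atoms (nat_adjoin \<alpha>) \<noteq> {}"
  shows "1 \<in> atoms (nat_adjoin \<alpha>)"
proof -
  have "atoms (nat_adjoin \<alpha>) \<subseteq> range ((^) \<alpha>)"
    by (intro atoms_subset_generators) (simp add: nat_adjoin_eq_hull)
  then show ?thesis using assms power_atom_imp_one_atom by blast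
qed

lemma power_le_poly_of_nat:
  assumes "\<alpha> > 0" "coeff f i \<noteq> 0"
  shows "\<alpha> ^ i \<le> poly (map_poly of_nat f) (\<alpha>::real)"
proof -
  have "\<alpha> ^ i \<le> of_nat (coeff f i) * \<alpha> ^ i"
    using assms by simp
  also have "\<dots> \<le> (\<Sum>i\<le>degree f. of_nat (coeff f i) * \<alpha> ^ i)"
    using assms le_degree[of f i] by (intro member_le_sum) auto
  finally show ?thesis by (simp add: poly_altdef coeff_map_poly degree_map_poly)
qed

text \<open>In a proper decomposition of \<open>\<alpha>\<^sup>k\<close> all powers that occur are smaller than \<open>\<alpha>\<^sup>k\<close>. For
  \<open>\<alpha> < 1\<close> their exponents thus exceed \<open>k\<close>, and division by \<open>\<alpha>\<^sup>k\<close> would decompose \<open>1\<close>.\<close>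

lemma power_not_atom_reduces:
  assumes "\<alpha> > 0" "1 \<in> atoms (nat_adjoin \<alpha>)" "\<alpha> ^ k \<notin> atoms (nat_adjoin \<alpha>)"
  obtains f where "\<And>i. i \<ge> k \<Longrightarrow> coeff f i = 0" "\<alpha> ^ k = poly (map_poly of_nat f) \<alpha>"
proof -
  obtain x y where xy: "x \<in> nat_adjoin \<alpha>" "y \<in> nat_adjoin \<alpha>" "\<alpha> ^ k = x + y" "x \<noteq> 0" "y \<noteq> 0"
    using assms(1,3) power_in_nat_adjoin[of \<alpha> k] unfolding atoms_def by auto
  then have pos: "x > 0" "y > 0"
    using nat_adjoin_nonneg[OF assms(1)] by force+
  then have less: "x < \<alpha> ^ k" "y < \<alpha> ^ k" using xy(3) by auto
  obtain f g where f: "x = poly (map_poly of_nat f) \<alpha>" and g: "y = poly (map_poly of_nat g) \<alpha>"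
    using xy(1,2) unfolding nat_adjoin_def by auto
  have lt: "\<alpha> ^ i < \<alpha> ^ k" if "coeff f i \<noteq> 0 \<or> coeff g i \<noteq> 0" for i
    using that less power_le_poly_of_nat[OF assms(1)] f g by (metis order_le_less_trans)
  consider "\<alpha> < 1" | "\<alpha> = 1" | "\<alpha> > 1" by linarith
  then show thesis
  proof cases
    case 1
    have gt: "i > k" if "coeff f i \<noteq> 0 \<or> coeff g i \<noteq> 0" for i
      using lt[OF that] 1 assms(1) by (simp add: power_strict_decreasing_iff)
    have div: "poly (map_poly of_nat h) \<alpha> / \<alpha> ^ k \<in> nat_adjoin \<alpha>"
      if "\<And>i. coeff h i \<noteq> 0 \<Longrightarrow> i > k" for h
    proof -
      \<comment> \<open>The elements whose quotient by \<open>\<alpha> ^ k\<close> stays in the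
        monoid form a submonoid, so only the powers occurring in \<open>h\<close> need to be
        checked.\<close>
      have "poly (map_poly of_nat h) \<alpha> \<in> {z. z / \<alpha> ^ k \<in> nat_adjoin \<alpha>}"
      proof (rule poly_in_add_submonoid)
        show "add_submonoid {z. z / \<alpha> ^ k \<in> nat_adjoin \<alpha>}"
          using add_submonoid_nat_adjoin[of \<alpha>] by (auto simp: add_submonoid_def add_divide_distrib)
        show "\<alpha> ^ i \<in> {z. z / \<alpha> ^ k \<in> nat_adjoin \<alpha>}" if "coeff h i \<noteq> 0" for i
          using \<open>coeff h i \<noteq> 0 \<Longrightarrow> i > k\<close>[OF that] assms(1) power_in_nat_adjoin[of \<alpha> "i - k"]
          by (simp add: power_diff)
      qed
      then show ?thesis by simp
    qed
    have "1 = x / \<alpha> ^ k + y / \<alpha> ^ k"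
      using xy(3) assms(1) by (metis add_divide_distrib divide_self power_not_zero order_less_irrefl)
    moreover have "x / \<alpha> ^ k \<in> nat_adjoin \<alpha>" "y / \<alpha> ^ k \<in> nat_adjoin \<alpha>"
      unfolding f g using gt by (auto intro!: div)
    ultimately have "x / \<alpha> ^ k = 0 \<or> y / \<alpha> ^ k = 0"
      using assms(2) unfolding atoms_def by blast
    then show thesis using xy(4,5) assms(1) by simp
  next
    case 2
    then show thesis using assms(2,3) by simp
  next
    case 3
    \<comment> \<open>For \<open>\<alpha> > 1\<close> a smaller power has a smaller exponent, so
      \<open>f + g\<close> itself is the required polynomial.\<close>
    have "coeff (f + g) i = 0" if "i \<ge> k" for i
    proof -
      have "\<alpha> ^ k \<le> \<alpha> ^ i" using 3 that by (simp add: power_increasing)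
      then show ?thesis using lt[of i] by force
    qed
    moreover have "map_poly of_nat (f + g) = map_poly of_nat f + (map_poly of_nat g :: real poly)"
      by (simp add: poly_eq_iff coeff_map_poly)
    then have "\<alpha> ^ k = poly (map_poly of_nat (f + g)) \<alpha>" using xy(3) f g by simp
    ultimately show thesis by (rule that)
  qed
qed

text \<open>A non-atomic power yields a monic relation of degree \<open>k\<close>, and
  \<open>k \<ge> 1\<close> because \<open>\<alpha> ^ 0\<close> is an atom. The case
  \<open>\<alpha> = 1\<close> stands apart: there every power is the atom 1, yet
  \<open>p = X\<close>, by the relation \<open>\<alpha> ^ 1 = 1\<close>.\<close>

lemma minimal_pair_monom_of_nonatom:
  assumes "\<alpha> > 0" "algebraic \<alpha>" "minimal_pair \<alpha> = (p, q)" "1 \<in> atoms (nat_adjoin \<alpha>)"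
    "\<alpha> = 1 \<or> (\<exists>k\<le>degree (min_poly \<alpha>). \<alpha> ^ k \<notin> atoms (nat_adjoin \<alpha>))"
  shows "\<exists>n\<ge>1. p = monom 1 n"
proof -
  have "\<exists>k f. k \<ge> 1 \<and> k \<le> degree (min_poly \<alpha>) \<and> (\<forall>i\<ge>k. coeff f i = 0)
      \<and> \<alpha> ^ k = poly (map_poly of_nat f) \<alpha>"
  proof (cases "\<alpha> = 1")
    case True
    show ?thesis
      using True degree_min_poly_pos[OF assms(2)]
      by (intro exI[of _ 1] exI[of _ "1 :: nat poly"]) (auto simp: map_poly_1)
  next
    case False
    then obtain k where k: "k \<le> degree (min_poly \<alpha>)" "\<alpha> ^ k \<notin> atoms (nat_adjoin \<alpha>)"
      using assms(5) by blast
    moreover have "k \<ge> 1" using k(2) assms(4) by (cases k) auto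
    ultimately show ?thesis
      using power_not_atom_reduces[OF assms(1,4)] by metis
  qed
  then show ?thesis
    using minimal_pair_of_monic_relation[OF assms(2)] assms(3) by (metis fst_conv)
qed

section \<open>Half-factoriality, or having exactly \<open>d\<close> atoms, forces \<open>p\<close>
  to be a power of \<open>X\<close>\<close>

lemma HFM_imp_minimal_pair_monom:
  assumes "\<alpha> > 0" "algebraic \<alpha>" "minimal_pair \<alpha> = (p, q)" "HFM (nat_adjoin \<alpha>)"
  shows "\<exists>n\<ge>1. p = monom 1 n"
proof (rule minimal_pair_monom_of_nonatom[OF assms(1-3)])
  let ?d = "degree (min_poly \<alpha>)"
  \<comment> \<open>Atomicity supplies an atom, since the empty set generates only 0 while the
    monoid contains 1.\<close>
  have "add_submonoid hull (atoms (nat_adjoin \<alpha>)) = nat_adjoin \<alpha>"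
    using assms(4) by (simp add: HFM_def atomic_def)
  moreover have "1 \<in> nat_adjoin \<alpha>"
    using power_in_nat_adjoin[of \<alpha> 0] by simp
  moreover have "add_submonoid hull {} = {0 :: real}"
    by (simp add: add_submonoid_hull_eq)
  ultimately have "atoms (nat_adjoin \<alpha>) \<noteq> {}"
    by (metis singletonD zero_neq_one)
  then show "1 \<in> atoms (nat_adjoin \<alpha>)"
    using one_atom_of_atoms_nonempty[OF assms(1)] by simp
  show "\<alpha> = 1 \<or> (\<exists>k\<le>?d. \<alpha> ^ k \<notin> atoms (nat_adjoin \<alpha>))"
  proof (rule ccontr)
    assume neg: "\<not> ?thesis"
    \<comment> \<open>For \<open>f\<close> of degree at most \<open>d\<close>, \<open>Z f\<close>
      reads \<open>f\<close> as a factorization of \<open>f(\<alpha>)\<close> into powers, all atoms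
      by \<open>neg\<close>; its length is \<open>f(1)\<close>.\<close>
    define Z where "Z = (\<lambda>f. \<Sum>i\<le>?d. replicate_mset (coeff f i) (\<alpha> ^ i))"
    have sz: "size (Z f) = (\<Sum>i\<le>?d. coeff f i)" for f
      by (simp add: Z_def)
    have Z: "Z f \<in> factorizations (nat_adjoin \<alpha>) (poly (map_poly of_nat f) \<alpha>)"
      if "\<And>i. i > ?d \<Longrightarrow> coeff f i = 0" for f
    proof -
      have "sum_mset (\<Sum>i\<in>I. replicate_mset (coeff f i) (\<alpha> ^ i)) = (\<Sum>i\<in>I. of_nat (coeff f i) * \<alpha> ^ i)"
        if "finite I" for I
        using that by (induction I rule: finite_induct) auto
      then have "sum_mset (Z f) = poly (map_poly of_nat f) \<alpha>"
        using poly_of_nat_eq_sum[of "Suc ?d" f \<alpha>] that by (simp add: Z_def lessThan_Suc_atMost)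
      moreover have "set_mset (Z f) \<subseteq> atoms (nat_adjoin \<alpha>)"
        using neg by (auto simp: Z_def set_mset_sum split: if_splits)
      ultimately show ?thesis by (simp add: factorizations_def)
    qed
    have "size (Z p) = size (Z q)"
    proof -
      have "Z p \<in> factorizations (nat_adjoin \<alpha>) (poly (map_poly of_nat p) \<alpha>)"
        "Z q \<in> factorizations (nat_adjoin \<alpha>) (poly (map_poly of_nat p) \<alpha>)"
        using Z[of p] Z[of q] minimal_pair_coeff_eq_0[OF assms(2,3)]
          minimal_pair_eval_eq[OF assms(2,3)] by auto
      moreover have "poly (map_poly of_nat p) \<alpha> \<in> nat_adjoin \<alpha>"
        unfolding nat_adjoin_def by blast
      ultimately show ?thesis using assms(4) unfolding HFM_def by blast
    qed
    then have "\<alpha> = 1"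
      unfolding sz by (rule minimal_pair_sum_coeff_eq[OF assms(2,3)])
    with neg show False by simp
  qed
qed

lemma card_atoms_imp_minimal_pair_monom:
  assumes "\<alpha> > 0" "algebraic \<alpha>" "minimal_pair \<alpha> = (p, q)"
    "finite (atoms (nat_adjoin \<alpha>))" "degree (min_poly \<alpha>) = card (atoms (nat_adjoin \<alpha>))"
  shows "\<exists>n\<ge>1. p = monom 1 n"
proof (rule minimal_pair_monom_of_nonatom[OF assms(1-3)])
  let ?d = "degree (min_poly \<alpha>)"
  show "1 \<in> atoms (nat_adjoin \<alpha>)"
    using degree_min_poly_pos[OF assms(2)] assms(5)
    by (intro one_atom_of_atoms_nonempty[OF assms(1)]) auto
  show "\<alpha> = 1 \<or> (\<exists>k\<le>?d. \<alpha> ^ k \<notin> atoms (nat_adjoin \<alpha>))"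
  proof (rule ccontr)
    assume neg: "\<not> ?thesis"
    \<comment> \<open>As \<alpha> is positive and not 1, its powers are distinct, which gives
      \<open>d + 1\<close> atoms.\<close>
    have "inj_on ((^) \<alpha>) {..?d}"
      using neg assms(1) by (auto simp: inj_on_def power_inject_exp')
    then have "card ((^) \<alpha> ` {..?d}) = Suc ?d" by (simp add: card_image)
    moreover have "card ((^) \<alpha> ` {..?d}) \<le> card (atoms (nat_adjoin \<alpha>))"
      using neg assms(4) by (intro card_mono) auto
    ultimately show False using assms(5) by simp
  qed
qed

theorem theorem5p4:
  fixes \<alpha> :: real
  assumes "\<alpha> > 0"
  shows "(\<not> algebraic \<alpha> \<longleftrightarrow> UFM (nat_adjoin \<alpha>) \<and> \<not> finitely_generated (nat_adjoin \<alpha>)) \<and>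
    (\<forall>p q. algebraic \<alpha> \<and> minimal_pair \<alpha> = (p, q) \<longrightarrow>
      (UFM (nat_adjoin \<alpha>) \<longleftrightarrow> HFM (nat_adjoin \<alpha>)) \<and>
      (HFM (nat_adjoin \<alpha>) \<longleftrightarrow>
        finite (atoms (nat_adjoin \<alpha>)) \<and> degree (min_poly \<alpha>) = card (atoms (nat_adjoin \<alpha>))) \<and>
      (finite (atoms (nat_adjoin \<alpha>)) \<and> degree (min_poly \<alpha>) = card (atoms (nat_adjoin \<alpha>)) \<longleftrightarrow>
        (\<exists>n\<ge>1. p = monom 1 n)))"
proof -
  let ?M = "nat_adjoin \<alpha>"
  have free: "UFM ?M \<and> HFM ?M \<and> finite (atoms ?M) \<and> degree (min_poly \<alpha>) = card (atoms ?M)"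
    if "algebraic \<alpha>" "minimal_pair \<alpha> = (p, q)" "\<exists>n\<ge>1. p = monom 1 n" for p q
    using that minimal_pair_monom_free UFM_imp_HFM by metis
  have HFM: "\<exists>n\<ge>1. p = monom 1 n"
    if "algebraic \<alpha>" "minimal_pair \<alpha> = (p, q)" "HFM ?M" for p q
    using HFM_imp_minimal_pair_monom[OF assms that] .
  have card: "\<exists>n\<ge>1. p = monom 1 n"
    if "algebraic \<alpha>" "minimal_pair \<alpha> = (p, q)" "finite (atoms ?M)"
      "degree (min_poly \<alpha>) = card (atoms ?M)" for p q
    using card_atoms_imp_minimal_pair_monom[OF assms that] .
  \<comment> \<open>The converse in (1), by contraposition: for algebraic \<alpha>, unique
    factorization forces \<open>p = X^n\<close>, hence only finitely many atoms.\<close>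
  have "finitely_generated ?M" if "algebraic \<alpha>" "UFM ?M"
  proof -
    obtain p q where "minimal_pair \<alpha> = (p, q)" by fastforce
    then have "finite (atoms ?M)" using free HFM UFM_imp_HFM that by blast
    then show ?thesis
      using that(2) finitely_generated_iff_finite_atoms unfolding UFM_def by blast
  qed
  moreover have "UFM ?M \<and> \<not> finitely_generated ?M" if "\<not> algebraic \<alpha>"
    using transcendental_UFM[OF that] by blast
  ultimately have "\<not> algebraic \<alpha> \<longleftrightarrow> UFM ?M \<and> \<not> finitely_generated ?M" by blast
  moreover have "(UFM ?M \<longleftrightarrow> HFM ?M) \<and>
      (HFM ?M \<longleftrightarrow> finite (atoms ?M) \<and> degree (min_poly \<alpha>) = card (atoms ?M)) \<and>
      (finite (atoms ?M) \<and> degree (min_poly \<alpha>) = card (atoms ?M) \<longleftrightarrow> (\<exists>n\<ge>1. p = monom 1 n))"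
    if pq: "algebraic \<alpha> \<and> minimal_pair \<alpha> = (p, q)" for p q
    using free[of p q] HFM[of p q] card[of p q] UFM_imp_HFM[of ?M] pq by argo
  ultimately show ?thesis by blast
qed

end
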